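(* Let $0<\alpha<1$, let $\lambda\in\mathbb{C}\setminus\{0\}$ with $\frac{\alpha\pi}{2}<|\arg(\lambda)|\le\pi$, and let $l\in\mathbb{N}=\{0,1,2,\dots\}$. Then there exist positive constants $M_l(\alpha,\lambda)$, $\hat{M}_l(\alpha,\lambda)$ and a positive real number $t_0$ such that the following statements hold: (i) $\left|\dfrac{d^l}{d\lambda^l}E_\alpha(\lambda t^\alpha)\right|\le\dfrac{M_l(\alpha,\lambda)}{t^\alpha}$ for any $t>t_0$; (ii) $\left|\dfrac{d^l}{d\lambda^l}E_{\alpha,\alpha}(\lambda t^\alpha)\right|\le\dfrac{\hat{M}_l(\alpha,\lambda)}{t^{2\alpha}}$ for any $t>t_0$.
   Context: For $\alpha>0$ and $\beta\in\mathbb{C}$, the Mittag-Leffler function is $E_{\alpha,\beta}(z)=\sum_{k=0}^\infty\frac{z^k}{\Gamma(\alpha k+\beta)}$ for $z\in\mathbb{C}$ (with $1/\Gamma$ taken to be $0$ at the poles of $\Gamma$), and $E_\alpha:=E_{\alpha,1}$. The argument $\arg$ takes values in $(-\pi,\pi]$. The symbol $\frac{d^l}{d\lambda^l}E_{\alpha,\beta}(\lambda t^\alpha)$ denotes the $l$-th complex derivative, with respect to $\lambda$ and for fixed $t$, of the entire function $\lambda\mapsto E_{\alpha,\beta}(\lambda t^\alpha)$, evaluated at the given $\lambda$. *)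

theory Defs
  imports "HOL-Complex_Analysis.Complex_Analysis"
begin

text \<open>
  The entire function \<^const>\<open>rGamma\<close> is the reciprocal of the Gamma function and
  vanishes at the poles of Gamma. The series converges for every \<open>z\<close> if \<open>\<alpha> > 0\<close>;
  the definition is meant for such \<open>\<alpha>\<close> only.
\<close>

definition mittag_leffler2 :: "real \<Rightarrow> complex \<Rightarrow> complex \<Rightarrow> complex" where
  "mittag_leffler2 \<alpha> \<beta> z = (\<Sum>k. z ^ k * rGamma (of_real \<alpha> * of_nat k + \<beta>))"

definition mittag_leffler :: "real \<Rightarrow> complex \<Rightarrow> complex" where
  "mittag_leffler \<alpha> = mittag_leffler2 \<alpha> 1"

end

theory Submission
  imports Defs
begin

text \<open>
  The proof uses a Mellin-Barnes integral. The function
  \<open>s \<mapsto> \<pi> (-z)\<^sup>s / (\<Gamma>(\<beta> + \<alpha> s) sin (\<pi> s))\<close> has residue \<open>z\<^sup>k / \<Gamma>(\<beta> + \<alpha> k)\<close> at every integer \<open>k\<close>,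
  and \<open>\<bar>1 / \<Gamma>(x + iy)\<bar>\<close> grows no faster than \<open>exp (\<pi> \<bar>y\<bar> / 2)\<close> up to powers of \<open>y\<close>. Hence it decays
  exponentially on vertical lines exactly when \<open>\<bar>arg (-z)\<bar> < \<pi> - \<alpha> \<pi> / 2\<close>, that is, when
  \<open>\<bar>arg z\<bar> > \<alpha> \<pi> / 2\<close>. The residue theorem on growing rectangles whose left edge lies on
  \<open>Re s = - m - 1/2\<close> then gives the expansion
  \<open>E(z) = - (\<Sum>j=1..m. z\<^bsup>-j\<^esup> / \<Gamma>(\<beta> - \<alpha> j)) + O(\<bar>z\<bar>\<^bsup>-m-1/2\<^esup>)\<close> in that sector. For \<open>\<beta> = \<alpha>\<close> the first term
  vanishes, which accounts for the better rate. Cauchy's inequality on a small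
  disc around \<open>lam\<close>, inside the sector, transfers the bound to all derivatives.
\<close>

subsection \<open>Growth of the reciprocal Gamma function\<close>

lemma power_le_fact_exp:
  fixes x :: real
  assumes "x \<ge> 0"
  shows "x ^ n \<le> fact n * exp x"
proof -
  have "x ^ n /\<^sub>R fact n = (\<Sum>k\<in>{n}. x ^ k /\<^sub>R fact k)" by simp
  also have "\<dots> \<le> (\<Sum>k. x ^ k /\<^sub>R fact k)"
    by (rule sum_le_suminf[OF summable_exp_generic]) (use assms in auto)
  also have "\<dots> = exp x" by (simp add: exp_def)
  finally show ?thesis by (simp add: field_simps)
qed

text \<open>Apply \<open>power_le_fact_exp\<close> to \<open>\<delta> / B * (A + B * y)\<close>: its
  exponential is exp(\<delta> y) up to the constant exp(\<delta> A / B), and the decay factor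
  cancels exp(\<delta> y).\<close>

lemma linear_power_times_exp_bounded:
  fixes A B \<delta> :: real
  assumes "A \<ge> 0" "B > 0" "\<delta> > 0"
  obtains K where "K \<ge> 0" "\<And>y. y \<ge> 0 \<Longrightarrow> (A + B * y) ^ n * exp (- \<delta> * y) \<le> K"
proof
  let ?K = "fact n * (B / \<delta>) ^ n * exp (\<delta> * A / B)"
  show "?K \<ge> 0" using assms by simp
  fix y :: real assume y: "y \<ge> 0"
  have "(\<delta> / B * (A + B * y)) ^ n \<le> fact n * exp (\<delta> / B * (A + B * y))"
    by (rule power_le_fact_exp) (use assms y in auto)
  hence "(\<delta> / B) ^ n * (A + B * y) ^ n \<le> fact n * (exp (\<delta> * A / B) * exp (\<delta> * y))"
    using assms by (simp add: power_mult_distrib power_divide flip: exp_add) (simp add: field_simps)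
  hence "(B / \<delta>) ^ n * ((\<delta> / B) ^ n * (A + B * y) ^ n) * exp (- \<delta> * y)
      \<le> (B / \<delta>) ^ n * (fact n * (exp (\<delta> * A / B) * exp (\<delta> * y))) * exp (- \<delta> * y)"
    using assms by (intro mult_right_mono mult_left_mono) auto
  also have "\<dots> = ?K * (exp (\<delta> * y) * exp (- \<delta> * y))" by (simp add: mult_ac)
  also have "exp (\<delta> * y) * exp (- \<delta> * y) = 1" by (simp add: exp_minus)
  finally show "(A + B * y) ^ n * exp (- \<delta> * y) \<le> ?K"
    using assms by (simp add: power_divide)
qed

lemma rGamma_real_nonneg: "x \<ge> 0 \<Longrightarrow> rGamma (x :: real) \<ge> 0"
  by (cases "x = 0") (auto simp: rGamma_inverse_Gamma Gamma_real_pos less_imp_le)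

text \<open>On Re s = 1/2 the conjugate of s is 1 - s, so the reflection formula turns
  |1/Gamma(s)|^2 into |sin(pi s)| / pi.\<close>

lemma norm_rGamma_half: "norm (rGamma (Complex (1/2) y)) \<le> exp (pi * \<bar>y\<bar> / 2) / sqrt pi"
proof -
  let ?s = "Complex (1/2) y"
  have "cnj ?s = 1 - ?s" by (simp add: complex_eq_iff)
  hence "rGamma ?s * cnj (rGamma ?s) = sin (of_real pi * ?s) / of_real pi"
    using rGamma_reflection_complex[of ?s] by (simp add: cnj_rGamma)
  hence "norm (rGamma ?s) ^ 2 = norm (sin (of_real pi * ?s)) / pi"
    by (metis complex_norm_square norm_divide norm_of_real norm_power abs_norm_cancel abs_of_pos pi_gt_zero)
  also have "\<dots> \<le> exp \<bar>Im (of_real pi * ?s)\<bar> / pi"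
    using cmod_sin_le_exp[of 1 "of_real pi * ?s"] by (intro divide_right_mono) auto
  also have "\<dots> = (exp (pi * \<bar>y\<bar> / 2) / sqrt pi) ^ 2"
    by (simp add: power_divide abs_mult flip: exp_of_nat_mult)
  finally show ?thesis by (rule power2_le_imp_le) simp
qed

text \<open>In the product formula each factor of \<open>\<bar>\<Gamma>(x + iy) / \<Gamma>(x)\<bar>\<close>, namely
  \<open>(1 + y\<^sup>2 / (x + k)\<^sup>2) powr (-1/2)\<close>, increases with \<open>x\<close>; at \<open>x = 1/2\<close> the reflection
  formula gives the exact value.\<close>

lemma norm_rGamma_le:
  assumes "x \<ge> 1/2"
  shows "norm (rGamma (Complex x y)) \<le> rGamma x * exp (pi * \<bar>y\<bar> / 2)"
proof -
  \<comment> \<open>Monotonicity in \<open>x\<close> of (x + k) / |x + k + iy|, with the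
    denominators cleared.\<close>
  have factor: "norm (Complex (x + k) y) * (1/2 + k) \<le> (x + k) * norm (Complex (1/2 + k) y)"
    if "k \<ge> 0" for k
  proof (rule power2_le_imp_le)
    have "(1/2 + k)\<^sup>2 * y\<^sup>2 \<le> (x + k)\<^sup>2 * y\<^sup>2"
      using assms that by (intro mult_right_mono power_mono) auto
    thus "(norm (Complex (x + k) y) * (1/2 + k))\<^sup>2 \<le> ((x + k) * norm (Complex (1/2 + k) y))\<^sup>2"
      unfolding power_mult_distrib cmod_power2 by (simp add: distrib_left distrib_right mult.commute)
  qed (use assms that in auto)
  have poch: "norm (pochhammer (Complex x y) n) * pochhammer (1/2) n
      \<le> pochhammer x n * norm (pochhammer (Complex (1/2) y) n)" for n
  proof -
    have shift: "Complex u y + of_nat k = Complex (u + k) y" for u k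
      by (simp add: complex_eq_iff)
    show ?thesis
      unfolding pochhammer_prod shift prod_norm[symmetric] prod.distrib[symmetric]
      by (rule prod_mono) (use factor in auto)
  qed
  have expo: "norm (exp (Complex u y * of_real r)) = exp (u * r)" for u r
    by (simp add: norm_exp_eq_Re)
  \<comment> \<open>Both sides of \<open>poch\<close> are divided by the same number, the product of
    the two \<open>rGamma_series\<close> denominators: exp(z ln n) has modulus exp(Re z ln
    n).\<close>
  have series: "norm (rGamma_series (Complex x y) n) * rGamma_series (1/2) n
      \<le> rGamma_series x n * norm (rGamma_series (Complex (1/2) y) n)" for n
    using mult_right_mono[OF poch[of "Suc n"],
        of "1 / (fact n * exp (x * ln n) * (fact n * exp (1/2 * ln n)))"]
    unfolding rGamma_series_def norm_divide norm_mult expo norm_fact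
    by (simp add: mult_ac)
  have "norm (rGamma (Complex x y)) * rGamma (1/2) \<le> rGamma x * norm (rGamma (Complex (1/2) y))"
    by (rule LIMSEQ_le[of "\<lambda>n. norm (rGamma_series (Complex x y) n) * rGamma_series (1/2) n"
          _ "\<lambda>n. rGamma_series x n * norm (rGamma_series (Complex (1/2) y) n)"])
       (intro tendsto_intros, intro tendsto_intros, use series in blast)
  also have "\<dots> \<le> rGamma x * (exp (pi * \<bar>y\<bar> / 2) / sqrt pi)"
    by (intro mult_left_mono norm_rGamma_half rGamma_real_nonneg) (use assms in auto)
  finally show ?thesis
    by (simp add: rGamma_inverse_Gamma Gamma_one_half_real field_simps)
qed

text \<open>Integer steps move \<open>u\<close> down to some \<open>v\<close> in [1/2, 3/2], where
  compactness gives a bound. The functional equation divides by \<open>pochhammer v n\<close> \<ge>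
  n! / 2^n, and (2R)^n / n! \<le> exp(2R) absorbs the powers of \<open>R\<close>.\<close>

lemma powr_rGamma_bounded:
  fixes R :: real
  assumes "R > 0"
  obtains B where "B \<ge> 0" "\<And>u. u \<ge> 1/2 \<Longrightarrow> R powr u * rGamma u \<le> B"
proof -
  have "compact ((\<lambda>v. R powr v * rGamma v) ` {1/2..3/2})"
    by (intro compact_continuous_image continuous_intros) (use assms in auto)
  then obtain C where C: "\<And>v. v \<in> {1/2..3/2} \<Longrightarrow> \<bar>R powr v * rGamma v\<bar> \<le> C"
    by (meson bounded_real compact_imp_bounded imageI)
  have C0: "C \<ge> 0" using C[of 1] by simp
  have "R powr u * rGamma u \<le> C * exp (2 * R)" if u: "u \<ge> 1/2" for u
  proof -
    define n where "n = nat \<lfloor>u - 1/2\<rfloor>"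
    define v where "v = u - n"
    have v: "v \<in> {1/2..3/2}" using u unfolding v_def n_def by (simp; linarith)
    have "fact n / 2 ^ n = (\<Prod>k<n. (1 + real k) / 2)"
      by (simp add: prod_dividef fact_prod_Suc lessThan_atLeast0)
    also have "\<dots> \<le> pochhammer v n"
      unfolding pochhammer_prod lessThan_atLeast0 by (rule prod_mono) (use v in \<open>auto simp: field_simps\<close>)
    finally have "fact n / 2 ^ n * rGamma u \<le> pochhammer v n * rGamma u"
      by (intro mult_right_mono rGamma_real_nonneg) (use u in auto)
    also have "\<dots> = rGamma v" using pochhammer_rGamma[of v n] by (simp add: v_def)
    finally have "rGamma u \<le> 2 ^ n / fact n * rGamma v" by (simp add: field_simps)
    hence "R powr u * rGamma u \<le> R powr (v + n) * (2 ^ n / fact n * rGamma v)"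
      unfolding v_def by (intro mult_mono) (use u in \<open>auto intro: rGamma_real_nonneg\<close>)
    also have "\<dots> = R powr v * rGamma v * ((2 * R) ^ n / fact n)"
      using assms by (simp add: powr_add powr_realpow power_mult_distrib)
    also have "\<dots> \<le> C * exp (2 * R)"
      using C[OF v] power_le_fact_exp[of "2 * R" n] assms C0
      by (intro mult_mono) (auto simp: field_simps)
    finally show ?thesis .
  qed
  thus ?thesis using that[of "C * exp (2 * R)"] C0 by simp
qed

text \<open>Substitute u = \<alpha> x + b and R = r^(1/\<alpha>). Since \<open>r\<close> is
  arbitrary, Gamma outgrows every geometric factor; this serves both the convergence of the series
  and the edges that go to infinity.\<close>

lemma powr_rGamma_linear_bounded:
  fixes \<alpha> b r :: real
  assumes "\<alpha> > 0" "r > 0"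
  obtains B where "B \<ge> 0" "\<And>x. \<alpha> * x + b \<ge> 1/2 \<Longrightarrow> r powr x * rGamma (\<alpha> * x + b) \<le> B"
proof -
  obtain B where B: "B \<ge> 0" "\<And>u. u \<ge> 1/2 \<Longrightarrow> (r powr (1/\<alpha>)) powr u * rGamma u \<le> B"
    using powr_rGamma_bounded[of "r powr (1/\<alpha>)"] assms by auto
  have "r powr x * rGamma (\<alpha> * x + b) \<le> r powr (- b / \<alpha>) * B" if "\<alpha> * x + b \<ge> 1/2" for x
  proof -
    have "r powr x = r powr (- b / \<alpha>) * (r powr (1/\<alpha>)) powr (\<alpha> * x + b)"
      using assms by (simp add: powr_powr field_simps flip: powr_add)
    thus ?thesis using mult_left_mono[OF B(2)[OF that], of "r powr (- b / \<alpha>)"]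
      by (simp add: mult_ac)
  qed
  thus ?thesis using that[of "r powr (- b / \<alpha>) * B"] B(1) by simp
qed

lemma norm_pochhammer_le:
  fixes w :: "'a :: {real_normed_field}"
  shows "norm (pochhammer w p) \<le> (norm w + p) ^ p"
proof -
  have "norm (pochhammer w p) = (\<Prod>k<p. norm (w + of_nat k))"
    by (simp add: pochhammer_prod lessThan_atLeast0 prod_norm)
  also have "\<dots> \<le> (\<Prod>k<p. norm w + p)"
    by (intro prod_mono) (auto intro!: norm_triangle_le)
  finally show ?thesis by simp
qed

text \<open>\<open>norm_rGamma_le\<close> stops at real part 1/2. Going \<open>p\<close> units
  further left by the functional equation costs only a polynomial factor, harmless against
  exponential decay.\<close>

lemma norm_rGamma_le_shifted:
  assumes "Re w + real p \<ge> 1/2"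
  shows "norm (rGamma w) \<le> (norm w + p) ^ p * (rGamma (Re w + p) * exp (pi * \<bar>Im w\<bar> / 2))"
proof -
  have eq: "w + of_nat p = Complex (Re w + p) (Im w)" by (simp add: complex_eq_iff)
  have "norm (rGamma w) = norm (pochhammer w p) * norm (rGamma (Complex (Re w + p) (Im w)))"
    by (subst pochhammer_rGamma[of w p]) (simp add: norm_mult eq)
  also have "\<dots> \<le> (norm w + p) ^ p * (rGamma (Re w + p) * exp (pi * \<bar>Im w\<bar> / 2))"
    by (intro mult_mono norm_pochhammer_le norm_rGamma_le assms) auto
  finally show ?thesis .
qed

text \<open>From 4 |sin(x + iy)|^2 = exp(2y) + exp(-2y) - 2 cos(2x). The hypothesis keeps
  \<open>s\<close> away from the integers in the two ways that occur on the rectangles: on vertical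
  edges the cosine is -1, on horizontal ones the exponential dominates it.\<close>

lemma norm_sin_pi_ge:
  assumes "Re s + 1/2 \<in> \<int> \<or> \<bar>Im s\<bar> \<ge> 1"
  shows "norm (sin (of_real pi * s)) \<ge> exp (pi * \<bar>Im s\<bar>) / 4"
proof (rule power2_le_imp_le)
  define E where "E = exp (2 * pi * \<bar>Im s\<bar>)"
  have E: "E \<le> exp (2 * (pi * Im s)) + inverse (exp (2 * (pi * Im s)))"
    by (cases "Im s \<ge> 0") (auto simp: E_def exp_minus mult_ac)
  have "E / 4 \<le> E - 2 * cos (2 * (pi * Re s))"
  proof (cases "Re s + 1/2 \<in> \<int>")
    case True
    then obtain k where "Re s + 1/2 = of_int k" by (auto elim: Ints_cases)
    hence "2 * (pi * Re s) = 2 * pi * of_int k - pi" by (simp add: algebra_simps flip: \<open>_ = of_int k\<close>)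
    hence "cos (2 * (pi * Re s)) = - 1" by (simp add: cos_diff)
    thus ?thesis by (simp add: E_def)
  next
    case False
    hence "1 \<le> \<bar>Im s\<bar>" using assms by auto
    hence "2 * pi * 1 \<le> 2 * pi * \<bar>Im s\<bar>" by (intro mult_left_mono) auto
    \<comment> \<open>\<open>E\<close> \<ge> 7 makes 3E/4 larger than 2, the most that the cosine
      term can take away.\<close>
    hence "1 + 2 * pi \<le> E" unfolding E_def using exp_ge_add_one_self[of "2 * pi * \<bar>Im s\<bar>"] by linarith
    hence "E \<ge> 7" using pi_gt3 by linarith
    moreover have "cos (2 * (pi * Re s)) \<le> 1" by simp
    ultimately show ?thesis by linarith
  qed
  also have "\<dots> \<le> 4 * norm (sin (of_real pi * s)) ^ 2"
    using E by (simp add: norm_sin_squared)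
  finally show "(exp (pi * \<bar>Im s\<bar>) / 4)\<^sup>2 \<le> (norm (sin (of_real pi * s)))\<^sup>2"
    by (simp add: E_def power_divide mult.assoc exp_double)
qed simp

subsection \<open>The Mellin-Barnes integrand\<close>

lemma summable_mittag_leffler2:
  assumes "\<alpha> > 0"
  shows "summable (\<lambda>k. z ^ k * rGamma (of_real \<alpha> * of_nat k + complex_of_real \<beta>))"
proof -
  \<comment> \<open>The factor 2 leaves a geometric majorant of ratio 1/2.\<close>
  define r where "r = 2 * (norm z + 1)"
  have r: "r > 0" by (simp add: r_def add_nonneg_pos)
  obtain B where B: "\<And>x. \<alpha> * x + \<beta> \<ge> 1/2 \<Longrightarrow> r powr x * rGamma (\<alpha> * x + \<beta>) \<le> B"
    using powr_rGamma_linear_bounded[OF assms r] by metis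
  \<comment> \<open>From \<open>N\<close> on the argument of \<open>rGamma\<close> is at least 1/2,
    as the bound requires.\<close>
  define N where "N = nat \<lceil>(1/2 - \<beta>) / \<alpha>\<rceil>"
  show ?thesis
  proof (rule summable_comparison_test'[of "\<lambda>k. B * (1/2) ^ k" N])
    show "summable (\<lambda>k. B * (1/2 :: real) ^ k)" by (intro summable_mult summable_geometric) auto
    fix k assume "k \<ge> N"
    hence "(1/2 - \<beta>) / \<alpha> \<le> k" unfolding N_def by linarith
    hence u: "\<alpha> * k + \<beta> \<ge> 1/2" using assms by (simp add: field_simps)
    have "complex_of_real \<alpha> * of_nat k + of_real \<beta> = of_real (\<alpha> * k + \<beta>)" by simp
    hence "norm (z ^ k * rGamma (of_real \<alpha> * of_nat k + complex_of_real \<beta>))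
        = norm z ^ k * rGamma (\<alpha> * k + \<beta>)"
      using rGamma_real_nonneg[of "\<alpha> * k + \<beta>"] u
      by (simp only: rGamma_complex_of_real norm_mult norm_power norm_of_real) simp
    also have "\<dots> \<le> (r / 2) ^ k * rGamma (\<alpha> * k + \<beta>)"
      by (intro mult_right_mono power_mono rGamma_real_nonneg) (use u in \<open>auto simp: r_def\<close>)
    also have "\<dots> = r powr k * rGamma (\<alpha> * k + \<beta>) * (1/2) ^ k"
      using r by (simp add: powr_realpow power_divide)
    also have "\<dots> \<le> B * (1/2) ^ k" by (intro mult_right_mono B u) auto
    finally show "norm (z ^ k * rGamma (of_real \<alpha> * of_nat k + complex_of_real \<beta>)) \<le> B * (1/2) ^ k" .
  qed
qed

lemma holomorphic_mittag_leffler2: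
  assumes "\<alpha> > 0"
  shows "mittag_leffler2 \<alpha> (of_real \<beta>) holomorphic_on A"
proof -
  let ?a = "\<lambda>k. rGamma (of_real \<alpha> * of_nat k + complex_of_real \<beta>)"
  have "mittag_leffler2 \<alpha> (of_real \<beta>) holomorphic_on ball 0 r" for r
    by (rule power_series_holomorphic[of _ _ ?a])
       (use summable_sums[OF summable_mittag_leffler2[OF assms]] in
         \<open>simp add: mittag_leffler2_def mult.commute\<close>)
  hence "mittag_leffler2 \<alpha> (of_real \<beta>) field_differentiable at z" for z
    using holomorphic_on_imp_differentiable_at[of _ "ball 0 (norm z + 1)" z] by simp
  thus ?thesis by (simp add: holomorphic_on_def field_differentiable_at_within)
qed

text \<open>\<open>exp (s * Ln (- z))\<close> is the principal (-z)^s, entire in \<open>s\<close>;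
  as \<open>rGamma\<close> is entire too, singularities can occur only at integers. There pi /
  sin(pi s) has residue (-1)^k, which the minus sign in -z cancels.\<close>

definition mellin_barnes :: "real \<Rightarrow> real \<Rightarrow> complex \<Rightarrow> complex \<Rightarrow> complex" where
  "mellin_barnes \<alpha> \<beta> z s =
    of_real pi * exp (s * Ln (- z)) * rGamma (of_real \<beta> + of_real \<alpha> * s) / sin (of_real pi * s)"

lemma sin_pi_eq_0_iff: "sin (of_real pi * s) = 0 \<longleftrightarrow> (s :: complex) \<in> \<int>"
proof -
  have "of_real pi * s = of_real (of_int n * pi) \<longleftrightarrow> s = of_int n" for n
    by (simp add: mult.commute)
  thus ?thesis unfolding sin_eq_0 Ints_def by auto
qed

lemma holomorphic_mellin_barnes:
  assumes "A \<inter> \<int> = {}"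
  shows "mellin_barnes \<alpha> \<beta> z holomorphic_on A"
  unfolding mellin_barnes_def
  by (intro holomorphic_intros) (use assms sin_pi_eq_0_iff in auto)

lemma exp_of_int_mult_Ln:
  assumes "z \<noteq> 0"
  shows "exp (of_int k * Ln z) = z powi k"
  using assms by (simp add: mult.commute flip: exp_power_int)

text \<open>As s tends to \<open>k\<close>, sin(pi s) / (s - k) tends to pi (-1)^k, so the residue
  is the limit of the integrand times s - k. This also covers a zero of \<open>rGamma\<close>, where
  the singularity is removable.\<close>

lemma residue_mellin_barnes:
  fixes \<alpha> \<beta> :: real
  assumes "z \<noteq> 0"
  shows "residue (mellin_barnes \<alpha> \<beta> z) (of_int k) = z powi k * of_real (rGamma (\<beta> + \<alpha> * k))"
proof -
  let ?k = "of_int k :: complex"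
  define h where "h = (\<lambda>s. exp (s * Ln (- z)) * rGamma (of_real \<beta> + of_real \<alpha> * s))"
  \<comment> \<open>\<open>e\<close> is its own inverse: the sign cos(pi k) moves from the
    denominator to the numerator, where it merges with (-z)^k.\<close>
  define e where "e = (- 1 :: complex) powi k"
  have e: "e * e = 1" by (simp add: e_def flip: power_int_mult_distrib)
  have cos_k: "cos (of_real pi * ?k) = e"
  proof -
    have "cos (of_real pi * ?k) = complex_of_real (cos (pi * of_int k))"
      by (metis cos_of_real of_real_mult of_real_of_int_eq)
    thus ?thesis by (cases "even k") (simp_all add: e_def power_int_minus_left)
  qed
  have "((\<lambda>s. sin (of_real pi * s)) has_field_derivative of_real pi * e) (at ?k)"
    by (auto intro!: derivative_eq_intros simp: cos_k)
  moreover have "sin (of_real pi * ?k) = 0" by (subst sin_pi_eq_0_iff) simp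
  ultimately have "((\<lambda>s. sin (of_real pi * s) / (s - ?k)) \<longlongrightarrow> of_real pi * e) (at ?k)"
    by (simp only: has_field_derivative_iff diff_zero)
  moreover have "isCont h ?k" unfolding h_def
    by (intro continuous_intros)
  hence "(h \<longlongrightarrow> h ?k) (at ?k)" by (simp add: isCont_def)
  moreover have "e \<noteq> 0" using e by auto
  ultimately have "((\<lambda>s. of_real pi * h s / (sin (of_real pi * s) / (s - ?k)))
      \<longlongrightarrow> of_real pi * h ?k / (of_real pi * e)) (at ?k)"
    by (intro tendsto_intros) auto
  also have "(\<lambda>s. of_real pi * h s / (sin (of_real pi * s) / (s - ?k)))
      = (\<lambda>s. mellin_barnes \<alpha> \<beta> z s * (s - ?k))"
    by (simp add: mellin_barnes_def h_def fun_eq_iff mult.assoc)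
  also have "of_real pi * h ?k / (of_real pi * e) = e * h ?k"
    using e \<open>e \<noteq> 0\<close> by (simp add: field_simps)
  also have "h ?k = (- z) powi k * rGamma (of_real (\<beta> + \<alpha> * k))"
    unfolding h_def using assms by (subst exp_of_int_mult_Ln) auto
  also have "e * \<dots> = z powi k * of_real (rGamma (\<beta> + \<alpha> * k))"
    unfolding e_def rGamma_complex_of_real
    by (simp flip: mult.assoc power_int_mult_distrib)
  finally have lim: "((\<lambda>s. mellin_barnes \<alpha> \<beta> z s * (s - ?k)) \<longlongrightarrow>
      z powi k * of_real (rGamma (\<beta> + \<alpha> * k))) (at ?k)" .
  \<comment> \<open>The open unit disc contains no second integer, so \<open>k\<close> is the only
    possible singularity in it.\<close>
  have "n = k" if "(of_int n :: complex) \<in> ball ?k 1" for n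
  proof -
    have "norm (of_int (k - n) :: complex) < 1" using that by (simp add: dist_norm)
    thus ?thesis unfolding norm_of_int by linarith
  qed
  hence "(ball ?k 1 - {?k}) \<inter> \<int> = {}" by (auto elim!: Ints_cases)
  thus ?thesis
    by (intro residue_simple'[OF open_ball _ holomorphic_mellin_barnes lim]) auto
qed

lemma contour_integral_mellin_barnes_rectpath:
  fixes m N :: nat and \<alpha> \<beta> Y :: real
  assumes "z \<noteq> 0" "Y > 0"
  shows "contour_integral (rectpath (Complex (- m - 1/2) (- Y)) (Complex (N + 1/2) Y)) (mellin_barnes \<alpha> \<beta> z)
    = 2 * pi * \<i> * (\<Sum>k\<in>{- int m..int N}. z powi k * of_real (rGamma (\<beta> + \<alpha> * k)))"
proof -
  let ?a = "Complex (- m - 1/2) (- Y)" and ?b = "Complex (N + 1/2) Y"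
  \<comment> \<open>An open strip around the rectangle that stops at the integers -m-1 and N+1, so
    that \<open>pts\<close> holds all the integers in it.\<close>
  define S where "S = {s. Re s > - m - 1} \<inter> {s. Re s < N + 1}"
  define pts where "pts = (of_int ` {- int m..int N} :: complex set)"
  have no_int: "(S - pts) \<inter> \<int> = {}"
  proof safe
    fix s assume s: "s \<in> S" "s \<notin> pts" "s \<in> \<int>"
    then obtain k where k: "s = of_int k" by (auto elim: Ints_cases)
    with s(1) have "- int m - 1 < k" "k < int N + 1" unfolding S_def by auto
    thus "s \<in> {}" using s(2) k by (auto simp: pts_def)
  qed
  have in_box: "p \<in> box ?a ?b" if "p \<in> pts" for p
    using that assms(2) by (auto simp: pts_def in_box_complex_iff)
  have cbox_S: "cbox ?a ?b \<subseteq> S" by (auto simp: S_def in_cbox_complex_iff)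
  have "contour_integral (rectpath ?a ?b) (mellin_barnes \<alpha> \<beta> z)
      = 2 * pi * \<i> * (\<Sum>p\<in>pts. winding_number (rectpath ?a ?b) p * residue (mellin_barnes \<alpha> \<beta> z) p)"
  proof (rule Residue_theorem[of S])
    show "open S" unfolding S_def by (intro open_Int open_halfspace_Re_gt open_halfspace_Re_lt)
    show "connected S" unfolding S_def
      by (intro convex_connected convex_Int convex_halfspace_Re_gt convex_halfspace_Re_lt)
    show "finite pts" by (simp add: pts_def)
    show "mellin_barnes \<alpha> \<beta> z holomorphic_on S - pts"
      by (rule holomorphic_mellin_barnes[OF no_int])
    show "path_image (rectpath ?a ?b) \<subseteq> S - pts"
      using in_box cbox_S assms(2) by (subst path_image_rectpath_cbox_minus_box) auto
    show "\<forall>s. s \<notin> S \<longrightarrow> winding_number (rectpath ?a ?b) s = 0"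
      using cbox_S assms(2) by (intro allI impI winding_number_rectpath_outside) auto
  qed auto
  also have "(\<Sum>p\<in>pts. winding_number (rectpath ?a ?b) p * residue (mellin_barnes \<alpha> \<beta> z) p)
      = (\<Sum>p\<in>pts. residue (mellin_barnes \<alpha> \<beta> z) p)"
    by (intro sum.cong refl) (subst winding_number_rectpath[OF in_box], auto)
  also have "\<dots> = (\<Sum>k\<in>{- int m..int N}. z powi k * of_real (rGamma (\<beta> + \<alpha> * k)))"
    unfolding pts_def by (subst sum.reindex) (auto simp: inj_on_def residue_mellin_barnes[OF assms(1)])
  finally show ?thesis .
qed

text \<open>With y = Im s, the factors contribute exp(\<psi> |y|) from (-z)^s, exp(\<alpha> pi |y| /
  2) from \<open>rGamma\<close> and exp(-pi |y|) from the sine. The shift \<open>p\<close> brings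
  the argument of \<open>rGamma\<close> into the half-plane of real part at least 1/2.\<close>

lemma norm_mellin_barnes_le:
  assumes "\<alpha> > 0" "z \<noteq> 0" "\<bar>Arg (- z)\<bar> \<le> \<psi>" "\<alpha> * Re s + \<beta> + real p \<ge> 1/2"
    and "Re s + 1/2 \<in> \<int> \<or> \<bar>Im s\<bar> \<ge> 1"
  shows "norm (mellin_barnes \<alpha> \<beta> z s) \<le>
    4 * pi * (\<alpha> * norm s + \<bar>\<beta>\<bar> + p) ^ p * (norm z powr Re s * rGamma (\<alpha> * Re s + \<beta> + p))
      * exp (- (pi - \<psi> - \<alpha> * pi / 2) * \<bar>Im s\<bar>)"
proof -
  let ?w = "of_real \<beta> + of_real \<alpha> * s :: complex" and ?y = "\<bar>Im s\<bar>"
  have w: "Re ?w = \<alpha> * Re s + \<beta>" "Im ?w = \<alpha> * Im s" by simp_all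
  have rG: "rGamma (\<alpha> * Re s + \<beta> + p) \<ge> 0" using assms(4) by (intro rGamma_real_nonneg) auto
  have "norm ?w + p \<le> \<alpha> * norm s + \<bar>\<beta>\<bar> + p"
    using norm_triangle_ineq[of "of_real \<beta>" "of_real \<alpha> * s"] assms(1) by (simp add: norm_mult)
  hence pow: "(norm ?w + p) ^ p \<le> (\<alpha> * norm s + \<bar>\<beta>\<bar> + p) ^ p" by (intro power_mono) auto
  have "norm (rGamma ?w) \<le> (norm ?w + p) ^ p * (rGamma (Re ?w + p) * exp (pi * \<bar>Im ?w\<bar> / 2))"
    by (rule norm_rGamma_le_shifted) (use assms(4) w in linarith)
  also have "\<dots> \<le> (\<alpha> * norm s + \<bar>\<beta>\<bar> + p) ^ p *
      (rGamma (\<alpha> * Re s + \<beta> + p) * exp (\<alpha> * pi / 2 * ?y))"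
    unfolding w using rG pow assms(1) by (intro mult_mono) (auto simp: abs_mult mult_ac)
  finally have 1: "norm (rGamma ?w) \<le> \<dots>" .
  have "- (Im s * Arg (- z)) \<le> \<bar>Im s\<bar> * \<bar>Arg (- z)\<bar>" by (metis abs_ge_minus_self abs_mult)
  also have "\<dots> \<le> \<psi> * ?y" using mult_left_mono[OF assms(3), of ?y] by (simp add: mult.commute)
  finally have "exp (Re s * ln (norm z) - Im s * Arg (- z)) \<le> exp (Re s * ln (norm z)) * exp (\<psi> * ?y)"
    by (simp flip: exp_add)
  hence 2: "norm (exp (s * Ln (- z))) \<le> norm z powr Re s * exp (\<psi> * ?y)"
    using assms(2) by (simp add: norm_exp_eq_Re powr_def Arg_def)
  have "inverse (norm (sin (of_real pi * s))) \<le> inverse (exp (pi * ?y) / 4)"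
    by (intro le_imp_inverse_le norm_sin_pi_ge assms) auto
  hence 3: "inverse (norm (sin (of_real pi * s))) \<le> 4 * exp (- pi * ?y)"
    by (simp add: exp_minus divide_simps)
  have "norm (mellin_barnes \<alpha> \<beta> z s)
      = pi * norm (exp (s * Ln (- z))) * norm (rGamma ?w) * inverse (norm (sin (of_real pi * s)))"
    by (simp only: mellin_barnes_def norm_divide norm_mult divide_inverse[of "_ :: real"]) simp
  also have "\<dots> \<le> pi * (norm z powr Re s * exp (\<psi> * ?y)) * ((\<alpha> * norm s + \<bar>\<beta>\<bar> + p) ^ p *
      (rGamma (\<alpha> * Re s + \<beta> + p) * exp (\<alpha> * pi / 2 * ?y))) * (4 * exp (- pi * ?y))"
    using rG assms(1) by (intro mult_mono 1 2 3) (auto intro!: mult_nonneg_nonneg)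
  also have "\<dots> = 4 * pi * (\<alpha> * norm s + \<bar>\<beta>\<bar> + p) ^ p * (norm z powr Re s * rGamma (\<alpha> * Re s + \<beta> + p))
      * (exp (\<psi> * ?y) * exp (\<alpha> * pi / 2 * ?y) * exp (- pi * ?y))"
    by (simp only: mult_ac)
  also have "exp (\<psi> * ?y) * exp (\<alpha> * pi / 2 * ?y) * exp (- pi * ?y)
      = exp (- (pi - \<psi> - \<alpha> * pi / 2) * ?y)"
    by (simp add: algebra_simps flip: exp_add)
  finally show ?thesis .
qed

text \<open>Integrating the majorant to an arctan makes the bound independent of \<open>Y\<close>,
  which later tends to infinity; length times maximum would grow with \<open>Y\<close>.\<close>

lemma norm_contour_integral_vertical_le:
  assumes "Y > 0" "f contour_integrable_on linepath (Complex c Y) (Complex c (- Y))"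
    and "K \<ge> 0" "\<And>y. \<bar>y\<bar> \<le> Y \<Longrightarrow> norm (f (Complex c y)) \<le> K / (1 + y\<^sup>2)"
  shows "norm (contour_integral (linepath (Complex c Y) (Complex c (- Y))) f) \<le> K * pi"
proof -
  let ?\<gamma> = "linepath (Complex c Y) (Complex c (- Y))"
  \<comment> \<open>On the path Im s = Y - 2Yx and the speed is 2Y, so \<open>g\<close> is the
    derivative of -K arctan(Y - 2Yx).\<close>
  define g where "g = (\<lambda>x::real. 2 * Y * K / (1 + (Y - 2 * Y * x)\<^sup>2))"
  have "(f has_contour_integral contour_integral ?\<gamma> f) ?\<gamma>"
    by (rule has_contour_integral_integral[OF assms(2)])
  hence I: "((\<lambda>x. f (?\<gamma> x) * (Complex c (- Y) - Complex c Y)) has_integral contour_integral ?\<gamma> f) {0..1}"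
    by (simp add: has_contour_integral_linepath)
  have J: "(g has_integral (- K * arctan (Y - 2 * Y * 1) - - K * arctan (Y - 2 * Y * 0))) {0..1}"
    by (rule fundamental_theorem_of_calculus)
       (auto intro!: derivative_eq_intros simp: g_def divide_simps mult_ac
          simp flip: has_real_derivative_iff_has_vector_derivative)
  have "norm (f (?\<gamma> x) * (Complex c (- Y) - Complex c Y)) \<le> g x" if x: "x \<in> {0..1}" for x
  proof -
    have eq: "?\<gamma> x = Complex c (Y - 2 * Y * x)"
      by (simp add: linepath_def complex_eq_iff algebra_simps)
    have "Y * x \<le> Y * 1" "0 \<le> Y * x" using x assms(1) by (intro mult_left_mono, auto)
    hence "\<bar>Y - 2 * Y * x\<bar> \<le> Y" by linarith
    hence "norm (f (?\<gamma> x)) \<le> K / (1 + (Y - 2 * Y * x)\<^sup>2)" unfolding eq by (rule assms(4))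
    moreover have "norm (Complex c (- Y) - Complex c Y) = 2 * Y"
      using assms(1) by (simp add: cmod_def real_sqrt_mult)
    ultimately show ?thesis using assms(1) mult_right_mono[of _ _ "2 * Y"]
      by (fastforce simp: g_def norm_mult mult_ac)
  qed
  hence "norm (contour_integral ?\<gamma> f) \<le> integral {0..1} g"
    using I J by (metis (no_types, lifting) has_integral_integrable integral_norm_bound_integral integral_unique)
  also have "\<dots> = K * (2 * arctan Y)" using integral_unique[OF J] by (simp add: arctan_minus)
  also have "\<dots> \<le> K * pi" using assms(3) arctan_ubound[of Y] by (intro mult_left_mono) auto
  finally show ?thesis .
qed

subsection \<open>Asymptotic expansion in the sector\<close>

text \<open>For the residue sum: negative indices produce the terms of the expansion, the others a
  partial sum of the Mittag-Leffler series.\<close>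

lemma sum_int_split_neg_nat:
  fixes g :: "int \<Rightarrow> 'a :: comm_monoid_add"
  shows "(\<Sum>k\<in>{- int m..int n}. g k) = (\<Sum>j=1..m. g (- int j)) + (\<Sum>k\<le>n. g (int k))"
proof -
  have "{- int m..int n} = (\<lambda>j. - int j) ` {1..m} \<union> int ` {..n}"
  proof (intro equalityI subsetI)
    fix k assume k: "k \<in> {- int m..int n}"
    show "k \<in> (\<lambda>j. - int j) ` {1..m} \<union> int ` {..n}"
    proof (cases "k < 0")
      case True
      hence "k = - int (nat (- k))" "nat (- k) \<in> {1..m}" using k by auto
      thus ?thesis by blast
    next
      case False
      hence "k = int (nat k)" "nat k \<in> {..n}" using k by auto
      thus ?thesis by blast
    qed
  qed auto
  moreover have "(\<lambda>j. - int j) ` {1..m} \<inter> int ` {..n} = {}" by auto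
  ultimately show ?thesis
    by (simp add: sum.union_disjoint sum.reindex inj_on_def)
qed

lemma contour_integral_rectpath_split:
  assumes "continuous_on (path_image (rectpath a b)) f" "Re a \<le> Re b" "Im a \<le> Im b"
  shows "contour_integral (rectpath a b) f =
      contour_integral (linepath a (Complex (Re b) (Im a))) f
    + contour_integral (linepath (Complex (Re b) (Im a)) b) f
    + contour_integral (linepath b (Complex (Re a) (Im b))) f
    + contour_integral (linepath (Complex (Re a) (Im b)) a) f"
proof -
  have img: "path_image (rectpath a b) = closed_segment a (Complex (Re b) (Im a))
      \<union> closed_segment (Complex (Re b) (Im a)) b \<union> closed_segment b (Complex (Re a) (Im b))
      \<union> closed_segment (Complex (Re a) (Im b)) a"
    by (simp add: rectpath_def Let_def path_image_join Un_assoc)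
  have int: "f contour_integrable_on linepath u v" if "closed_segment u v \<subseteq> path_image (rectpath a b)" for u v
    using that assms(1) by (intro contour_integrable_continuous_linepath) (blast intro: continuous_on_subset)
  have ints: "f contour_integrable_on linepath a (Complex (Re b) (Im a))"
    "f contour_integrable_on linepath (Complex (Re b) (Im a)) b"
    "f contour_integrable_on linepath b (Complex (Re a) (Im b))"
    "f contour_integrable_on linepath (Complex (Re a) (Im b)) a"
    by (intro int; use img in blast)+
  thus "contour_integral (rectpath a b) f =
      contour_integral (linepath a (Complex (Re b) (Im a))) f
    + contour_integral (linepath (Complex (Re b) (Im a)) b) f
    + contour_integral (linepath b (Complex (Re a) (Im b))) f
    + contour_integral (linepath (Complex (Re a) (Im b)) a) f"
    unfolding rectpath_def Let_def by (simp add: add.assoc valid_path_join)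
qed

text \<open>\<open>K\<close> must not depend on \<open>z\<close>: the power of |z| is then the whole
  error term. With Re s fixed the Gamma factor is a constant, and exponential decay absorbs all
  powers of \<open>y\<close>.\<close>

lemma mellin_barnes_left_edge_bound:
  fixes \<alpha> \<beta> c :: real
  assumes "\<alpha> > 0" "\<psi> + \<alpha> * pi / 2 < pi" "c + 1/2 \<in> \<int>"
  obtains K where "K \<ge> 0" "\<And>z y. z \<noteq> 0 \<Longrightarrow> \<bar>Arg (- z)\<bar> \<le> \<psi> \<Longrightarrow>
    norm (mellin_barnes \<alpha> \<beta> z (Complex c y)) \<le> K * norm z powr c / (1 + y\<^sup>2)"
proof -
  obtain p :: nat where p: "p \<ge> 1/2 - (\<alpha> * c + \<beta>)" using real_arch_simple by blast
  define \<delta> where "\<delta> = pi - \<psi> - \<alpha> * pi / 2"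
  define A where "A = 1 + \<alpha> * \<bar>c\<bar> + \<bar>\<beta>\<bar> + p"
  \<comment> \<open>\<open>p\<close> powers come from the shift of the Gamma argument; two more pay
    for the factor 1 + y^2.\<close>
  obtain L where L: "L \<ge> 0" "\<And>y. y \<ge> 0 \<Longrightarrow> (A + (1 + \<alpha>) * y) ^ (p + 2) * exp (- \<delta> * y) \<le> L"
    by (rule linear_power_times_exp_bounded[of A "1 + \<alpha>" \<delta> "p + 2"]) (use assms in \<open>auto simp: A_def \<delta>_def\<close>)
  define G where "G = rGamma (\<alpha> * c + \<beta> + p)"
  have G: "G \<ge> 0" unfolding G_def by (intro rGamma_real_nonneg) (use p in linarith)
  have "norm (mellin_barnes \<alpha> \<beta> z (Complex c y)) \<le> 4 * pi * G * L * norm z powr c / (1 + y\<^sup>2)"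
    if z: "z \<noteq> 0" "\<bar>Arg (- z)\<bar> \<le> \<psi>" for z y
  proof -
    let ?q = "A + (1 + \<alpha>) * \<bar>y\<bar>" and ?P = "(\<alpha> * norm (Complex c y) + \<bar>\<beta>\<bar> + p) ^ p"
    have "norm (Complex c y) \<le> \<bar>c\<bar> + \<bar>y\<bar>" using cmod_le[of "Complex c y"] by simp
    hence "\<alpha> * norm (Complex c y) \<le> \<alpha> * (\<bar>c\<bar> + \<bar>y\<bar>)" using assms(1) by (intro mult_left_mono) auto
    hence "?P \<le> ?q ^ p"
      using assms(1) by (intro power_mono) (auto simp: A_def algebra_simps)
    moreover have "1 + y\<^sup>2 \<le> ?q ^ 2"
    proof -
      have "1 + \<bar>y\<bar> \<le> ?q" using assms(1) by (simp add: A_def algebra_simps)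
      hence "(1 + \<bar>y\<bar>)\<^sup>2 \<le> ?q\<^sup>2" by (intro power_mono) auto
      thus ?thesis by (simp add: power2_sum)
    qed
    ultimately have "?P * (1 + y\<^sup>2) \<le> ?q ^ p * ?q ^ 2"
      using assms(1) by (intro mult_mono) (auto simp: A_def)
    hence "?P * (1 + y\<^sup>2) * exp (- \<delta> * \<bar>y\<bar>) \<le> ?q ^ (p + 2) * exp (- \<delta> * \<bar>y\<bar>)"
      by (intro mult_right_mono) (simp_all only: power_add exp_ge_zero)
    also have "\<dots> \<le> L" by (rule L) simp
    finally have "?P * exp (- \<delta> * \<bar>y\<bar>) \<le> L / (1 + y\<^sup>2)"
      by (simp add: pos_le_divide_eq add_pos_nonneg mult_ac)
    hence "4 * pi * (norm z powr c * G) * (?P * exp (- \<delta> * \<bar>y\<bar>))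
        \<le> 4 * pi * (norm z powr c * G) * (L / (1 + y\<^sup>2))"
      using G by (intro mult_left_mono) auto
    moreover have "norm (mellin_barnes \<alpha> \<beta> z (Complex c y)) \<le> 4 * pi * ?P * (norm z powr c * G) * exp (- \<delta> * \<bar>y\<bar>)"
      using norm_mellin_barnes_le[of \<alpha> z \<psi> "Complex c y" \<beta> p] assms z p
      unfolding G_def \<delta>_def by simp
    ultimately show ?thesis by (simp add: mult_ac)
  qed
  thus ?thesis using that[of "4 * pi * G * L"] G L(1) by simp
qed

text \<open>Here \<open>z\<close> is fixed and \<open>\<epsilon>\<close> may depend on it. The
  factor \<open>2 * n + m + 1\<close> bounds the length of each of the three moving edges, so
  \<open>\<epsilon> n\<close> bounds the integral over each.\<close>

lemma mellin_barnes_far_edges_bound: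
  fixes \<alpha> \<beta> :: real and m :: nat
  assumes "\<alpha> > 0" "\<psi> + \<alpha> * pi / 2 < pi" "z \<noteq> 0" "\<bar>Arg (- z)\<bar> \<le> \<psi>"
  obtains \<epsilon> :: "nat \<Rightarrow> real" where "\<epsilon> \<longlonglongrightarrow> 0" "\<And>n. \<epsilon> n \<ge> 0"
    "\<And>n s. n \<ge> 1 \<Longrightarrow> Re s \<in> {- real m - 1/2..n + 1/2} \<Longrightarrow> \<bar>Im s\<bar> \<le> n \<Longrightarrow> Re s = n + 1/2 \<or> \<bar>Im s\<bar> = n \<Longrightarrow>
      norm (mellin_barnes \<alpha> \<beta> z s) * (2 * n + m + 1) \<le> \<epsilon> n"
proof -
  define c where "c = - real m - 1/2"
  obtain p :: nat where p: "p \<ge> 1/2 - (\<alpha> * c + \<beta>)" using real_arch_simple by blast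
  \<comment> \<open>Two sources of decay: exp(-D n) with D = pi - \<psi> - \<alpha> pi / 2 on the
    horizontal edges, and 2^(-n) on the right edge.\<close>
  define \<delta> where "\<delta> = min (pi - \<psi> - \<alpha> * pi / 2) (ln 2)"
  define A where "A = 1 + m + \<alpha> * (m + 1) + \<bar>\<beta>\<bar> + p"
  define B where "B = 2 + 2 * \<alpha>"
  have \<delta>: "\<delta> > 0" using assms(2) by (auto simp: \<delta>_def)
  have A: "A \<ge> 1" and B: "B > 0" using assms(1) by (auto simp: A_def B_def)
  \<comment> \<open>Again \<open>p\<close> powers come from the shift; one more pays for the edge
    length, and the last leaves the denominator \<open>A + B * n\<close> of
    \<open>\<epsilon>\<close>.\<close>
  obtain L where L: "L \<ge> 0" "\<And>y. y \<ge> 0 \<Longrightarrow> (A + B * y) ^ (p + 2) * exp (- \<delta> * y) \<le> L"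
    by (rule linear_power_times_exp_bounded[of A B \<delta> "p + 2"]) (use A B \<delta> in auto)
  \<comment> \<open>The base 2|z| in place of |z| yields a spare factor 2^(-Re s), which supplies
    the decay on the right edge near the real axis.\<close>
  obtain G where G: "G \<ge> 0"
    "\<And>x. \<alpha> * x + (\<beta> + p) \<ge> 1/2 \<Longrightarrow> (2 * norm z) powr x * rGamma (\<alpha> * x + (\<beta> + p)) \<le> G"
    by (rule powr_rGamma_linear_bounded[of \<alpha> "2 * norm z" "\<beta> + p"]) (use assms in auto)
  define H where "H = 4 * pi * G * 2 powr (- c) * L"
  define \<epsilon> where "\<epsilon> = (\<lambda>n::nat. H / (A + B * n))"
  have H: "H \<ge> 0" using G(1) L(1) by (simp add: H_def)
  have "filterlim (\<lambda>n::nat. A + B * n) at_top sequentially"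
    by (intro filterlim_tendsto_add_at_top[OF tendsto_const]
        filterlim_tendsto_pos_mult_at_top[OF tendsto_const B] filterlim_real_sequentially)
  hence "\<epsilon> \<longlonglongrightarrow> 0" unfolding \<epsilon>_def
    by (intro tendsto_divide_0[OF tendsto_const] filterlim_at_top_imp_at_infinity)
  moreover have "\<epsilon> n \<ge> 0" for n using H A B by (simp add: \<epsilon>_def)
  moreover have "norm (mellin_barnes \<alpha> \<beta> z s) * (2 * n + m + 1) \<le> \<epsilon> n"
    if s: "n \<ge> 1" "Re s \<in> {- real m - 1/2..n + 1/2}" "\<bar>Im s\<bar> \<le> n" "Re s = n + 1/2 \<or> \<bar>Im s\<bar> = n" for n :: nat and s
  proof -
    let ?x = "Re s" and ?y = "\<bar>Im s\<bar>" and ?q = "A + B * n"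
    let ?P = "(\<alpha> * norm s + \<bar>\<beta>\<bar> + p) ^ p" and ?D = "pi - \<psi> - \<alpha> * pi / 2"
    have "\<alpha> * c \<le> \<alpha> * ?x" using s(2) assms(1) unfolding c_def by (intro mult_left_mono) auto
    hence u: "\<alpha> * ?x + (\<beta> + p) \<ge> 1/2" using p by linarith
    have "Re s + 1/2 \<in> \<int>" if "Re s = n + 1/2"
      using that by (simp add: add.assoc)
    hence bdry: "Re s + 1/2 \<in> \<int> \<or> ?y \<ge> 1" using s(1,4) by fastforce
    have q1: "?q \<ge> 1" using A B by (smt (verit) mult_nonneg_nonneg of_nat_0_le_iff)
    have "norm s \<le> \<bar>?x\<bar> + ?y" by (rule cmod_le)
    also have "\<dots> \<le> m + 1 + 2 * real n" using s(2,3) by auto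
    finally have "\<alpha> * norm s \<le> \<alpha> * (m + 1 + 2 * real n)" using assms(1) by (intro mult_left_mono) auto
    hence "\<alpha> * norm s + \<bar>\<beta>\<bar> + p \<le> ?q" by (simp add: A_def B_def algebra_simps)
    hence P: "?P \<le> ?q ^ p" using assms(1) by (intro power_mono) auto
    have edge: "2 powr (- ?x) * exp (- ?D * ?y) \<le> 2 powr (- c) * exp (- \<delta> * n)"
    proof (cases "?y = n")
      case True
      have "2 powr (- ?x) \<le> 2 powr (- c)" using s(2) by (intro powr_mono) (auto simp: c_def)
      moreover have "\<delta> * n \<le> ?D * n" by (intro mult_right_mono) (auto simp: \<delta>_def)
      hence "exp (- ?D * ?y) \<le> exp (- \<delta> * n)"
        by (simp only: True exp_le_cancel_iff mult_minus_left neg_le_iff_le)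
      ultimately show ?thesis by (intro mult_mono) auto
    next
      case False
      hence x: "?x = n + 1/2" using s(4) by blast
      have "\<delta> * n \<le> ln 2 * n" by (intro mult_right_mono) (auto simp: \<delta>_def)
      also have "\<dots> \<le> ln 2 * ?x" unfolding x by (intro mult_left_mono) auto
      finally have "2 powr (- ?x) \<le> exp (- \<delta> * n)" by (simp add: powr_def mult.commute)
      moreover have "exp (- ?D * ?y) \<le> 1" using assms(2) by (simp add: mult_le_0_iff)
      moreover have "1 \<le> 2 powr (- c)" by (intro ge_one_powr_ge_zero) (auto simp: c_def)
      ultimately have "2 powr (- ?x) * exp (- ?D * ?y) \<le> exp (- \<delta> * n) * 1" 
        "1 * exp (- \<delta> * n) \<le> 2 powr (- c) * exp (- \<delta> * n)"
        by (intro mult_mono; simp)+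
      thus ?thesis by linarith
    qed
    have "norm z powr ?x * rGamma (\<alpha> * ?x + \<beta> + p)
        = (2 * norm z) powr ?x * rGamma (\<alpha> * ?x + (\<beta> + p)) * 2 powr (- ?x)"
      by (simp add: powr_mult powr_minus field_simps add_ac)
    also have "\<dots> \<le> G * 2 powr (- ?x)" by (intro mult_right_mono G(2) u) auto
    finally have g: "norm z powr ?x * rGamma (\<alpha> * ?x + \<beta> + p) \<le> G * 2 powr (- ?x)" .
    have rG: "rGamma (\<alpha> * ?x + \<beta> + p) \<ge> 0" by (intro rGamma_real_nonneg) (use u in linarith)
    have "norm (mellin_barnes \<alpha> \<beta> z s) \<le>
        4 * pi * ?P * (norm z powr ?x * rGamma (\<alpha> * ?x + \<beta> + p)) * exp (- ?D * ?y)"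
      using u by (intro norm_mellin_barnes_le assms bdry) auto
    also have "\<dots> \<le> 4 * pi * ?q ^ p * (G * 2 powr (- ?x)) * exp (- ?D * ?y)"
      using rG q1 by (intro mult_right_mono mult_mono[OF _ g] mult_left_mono P) (auto intro!: mult_nonneg_nonneg)
    also have "\<dots> = 4 * pi * ?q ^ p * G * (2 powr (- ?x) * exp (- ?D * ?y))" by (simp add: mult_ac)
    also have "\<dots> \<le> 4 * pi * ?q ^ p * G * (2 powr (- c) * exp (- \<delta> * n))"
      using q1 G(1) edge by (intro mult_left_mono) auto
    finally have 1: "norm (mellin_barnes \<alpha> \<beta> z s) \<le> \<dots>" .
    have "2 * n + m + 1 \<le> ?q" using assms(1) by (simp add: A_def B_def algebra_simps)
    hence "norm (mellin_barnes \<alpha> \<beta> z s) * (2 * n + m + 1)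
        \<le> 4 * pi * ?q ^ p * G * (2 powr (- c) * exp (- \<delta> * n)) * ?q"
      using q1 G(1) by (intro mult_mono[OF 1]) auto
    also have "\<dots> = 4 * pi * G * 2 powr (- c) * (?q ^ (p + 2) * exp (- \<delta> * n)) / ?q"
      using q1 by (simp add: power2_eq_square power_add)
    also have "\<dots> \<le> 4 * pi * G * 2 powr (- c) * L / ?q"
      using q1 G(1) by (intro divide_right_mono mult_left_mono L(2)) auto
    finally show ?thesis by (simp add: \<epsilon>_def H_def)
  qed
  ultimately show ?thesis using that by blast
qed

text \<open>The rectangle grows with its left edge kept on Re s = c. The far edges vanish in the
  limit, the residues become the series plus the expansion terms, and the left edge gives at most pi
  K |z|^c; division by 2 pi leaves K / 2.\<close>

lemma mittag_leffler2_asymptotics: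
  fixes \<alpha> \<beta> :: real and m :: nat
  assumes "\<alpha> > 0" "\<psi> + \<alpha> * pi / 2 < pi"
  obtains C where "C \<ge> 0" "\<And>z. z \<noteq> 0 \<Longrightarrow> \<bar>Arg (- z)\<bar> \<le> \<psi> \<Longrightarrow>
    norm (mittag_leffler2 \<alpha> (of_real \<beta>) z + (\<Sum>j=1..m. of_real (rGamma (\<beta> - \<alpha> * j)) / z ^ j))
      \<le> C * norm z powr (- real m - 1/2)"
proof -
  define c where "c = - real m - 1/2"
  have "c + 1/2 \<in> \<int>" by (simp add: c_def)
  then obtain K where K: "K \<ge> 0" "\<And>z y. z \<noteq> 0 \<Longrightarrow> \<bar>Arg (- z)\<bar> \<le> \<psi> \<Longrightarrow>
      norm (mellin_barnes \<alpha> \<beta> z (Complex c y)) \<le> K * norm z powr c / (1 + y\<^sup>2)"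
    using mellin_barnes_left_edge_bound[OF assms] by metis
  have "norm (mittag_leffler2 \<alpha> (of_real \<beta>) z + (\<Sum>j=1..m. of_real (rGamma (\<beta> - \<alpha> * j)) / z ^ j))
      \<le> K / 2 * norm z powr c" if z: "z \<noteq> 0" "\<bar>Arg (- z)\<bar> \<le> \<psi>" for z
  proof -
    let ?f = "mellin_barnes \<alpha> \<beta> z" and ?g = "\<lambda>k. z powi k * of_real (rGamma (\<beta> + \<alpha> * of_int k))"
    let ?S = "\<Sum>j=1..m. of_real (rGamma (\<beta> - \<alpha> * j)) / z ^ j"
    define T where "T n = (\<Sum>k\<le>n. z ^ k * rGamma (of_real \<alpha> * of_nat k + of_real \<beta>))" for n
    obtain \<epsilon> :: "nat \<Rightarrow> real" where \<epsilon>: "\<epsilon> \<longlonglongrightarrow> 0" "\<And>n. \<epsilon> n \<ge> 0"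
      "\<And>n s. n \<ge> 1 \<Longrightarrow> Re s \<in> {- real m - 1/2..n + 1/2} \<Longrightarrow> \<bar>Im s\<bar> \<le> n \<Longrightarrow> Re s = n + 1/2 \<or> \<bar>Im s\<bar> = n \<Longrightarrow>
        norm (?f s) * (2 * n + m + 1) \<le> \<epsilon> n"
      using mellin_barnes_far_edges_bound[OF assms z, of m \<beta>] by metis
    have sum_eq: "(\<Sum>k\<in>{- int m..int n}. ?g k) = ?S + T n" for n
    proof -
      have nonneg: "z ^ k * rGamma (of_real \<alpha> * of_nat k + of_real \<beta>) = ?g (int k)" for k
        by (simp add: add.commute flip: rGamma_complex_of_real)
      have neg: "?g (- int j) = of_real (rGamma (\<beta> - \<alpha> * j)) / z ^ j" for j
        by (simp add: power_int_minus field_simps)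
      show ?thesis unfolding T_def sum_int_split_neg_nat by (simp only: nonneg neg)
    qed
    have bound: "2 * pi * norm (?S + T n) \<le> K * norm z powr c * pi + 3 * \<epsilon> n" if n: "n \<ge> 1" for n
    proof -
      let ?a = "Complex c (- real n)" and ?b = "Complex (n + 1/2) n"
      let ?a' = "Complex (n + 1/2) (- real n)" and ?b' = "Complex c n"
      have n0: "real n > 0" using n by simp
      have c_le: "c \<le> n + 1/2" by (simp add: c_def)
      have "path_image (rectpath ?a ?b) \<inter> \<int> = {}"
      proof safe
        fix s assume s: "s \<in> path_image (rectpath ?a ?b)" "s \<in> \<int>"
        then obtain k where k: "s = of_int k" by (auto elim: Ints_cases)
        \<comment> \<open>Only the vertical edges meet the real axis, at half-integers; doubling
          makes an even number equal to an odd one.\<close>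
        have "of_int (2 * k) = 2 * c \<or> of_int (2 * k) = 2 * (n + 1/2)"
          using s(1) n0 c_le unfolding k by (auto simp: path_image_rectpath)
        hence "of_int (2 * k) = real_of_int (- 2 * int m - 1) \<or> of_int (2 * k) = real_of_int (2 * int n + 1)"
          unfolding c_def by simp
        hence "2 * k = - 2 * int m - 1 \<or> 2 * k = 2 * int n + 1" by (simp only: of_int_eq_iff)
        hence False by presburger
        thus "s \<in> {}" ..
      qed
      hence cont: "continuous_on (path_image (rectpath ?a ?b)) ?f"
        by (intro holomorphic_on_imp_continuous_on holomorphic_mellin_barnes)
      have far: "norm (?f s) * (2 * n + m + 1) \<le> \<epsilon> n"
        if "Re s \<in> {c..n + 1/2}" "\<bar>Im s\<bar> \<le> n" "Re s = n + 1/2 \<or> \<bar>Im s\<bar> = n" for s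
        using \<epsilon>(3)[OF n] that by (simp add: c_def)
      \<comment> \<open>Length times maximum; \<open>far\<close> has the length factor built
        in.\<close>
      have edge: "norm (contour_integral (linepath u v) ?f) \<le> \<epsilon> n"
        if int: "?f contour_integrable_on linepath u v" and len: "norm (v - u) \<le> 2 * n + m + 1"
          and seg: "\<And>s. s \<in> closed_segment u v \<Longrightarrow>
            Re s \<in> {c..n + 1/2} \<and> \<bar>Im s\<bar> \<le> n \<and> (Re s = n + 1/2 \<or> \<bar>Im s\<bar> = n)" for u v
      proof -
        let ?l = "2 * n + m + 1 :: real"
        have "norm (contour_integral (linepath u v) ?f) \<le> \<epsilon> n / ?l * norm (v - u)"
          by (rule contour_integral_bound_linepath[OF int])
             (use \<epsilon>(2)[of n] far seg in \<open>auto simp: pos_le_divide_eq add_nonneg_pos\<close>)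
        also have "\<dots> \<le> \<epsilon> n / ?l * ?l" using len \<epsilon>(2)[of n] by (intro mult_left_mono) auto
        also have "\<dots> = \<epsilon> n" by (simp add: add_nonneg_eq_0_iff)
        finally show ?thesis .
      qed
      have img: "path_image (rectpath ?a ?b) = closed_segment ?a ?a' \<union> closed_segment ?a' ?b
          \<union> closed_segment ?b ?b' \<union> closed_segment ?b' ?a"
        by (simp add: rectpath_def Let_def path_image_join Un_assoc)
      have int: "?f contour_integrable_on linepath u v"
        if "closed_segment u v \<subseteq> path_image (rectpath ?a ?b)" for u v
        using that cont by (intro contour_integrable_continuous_linepath) (blast intro: continuous_on_subset)
      have e1: "norm (contour_integral (linepath ?a ?a') ?f) \<le> \<epsilon> n"
      proof (rule edge)
        show "?f contour_integrable_on linepath ?a ?a'" by (rule int) (use img in blast)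
        have "?a' - ?a = of_real (n + 1/2 - c)" by (simp add: complex_eq_iff)
        hence "norm (?a' - ?a) = \<bar>n + 1/2 - c\<bar>" by (simp only: norm_of_real)
        thus "norm (?a' - ?a) \<le> 2 * n + m + 1" by (simp add: c_def)
      qed (use c_le in \<open>auto simp: closed_segment_same_Im closed_segment_eq_real_ivl split: if_splits\<close>)
      have e2: "norm (contour_integral (linepath ?a' ?b) ?f) \<le> \<epsilon> n"
      proof (rule edge)
        show "?f contour_integrable_on linepath ?a' ?b" by (rule int) (use img in blast)
        have "?b - ?a' = of_real (2 * n) * \<i>" by (simp add: complex_eq_iff)
        hence "norm (?b - ?a') = \<bar>2 * n\<bar>" by (simp only: norm_mult norm_of_real) simp
        thus "norm (?b - ?a') \<le> 2 * n + m + 1" by simp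
      qed (use c_le n0 in \<open>auto simp: closed_segment_same_Re closed_segment_eq_real_ivl\<close>)
      have e3: "norm (contour_integral (linepath ?b ?b') ?f) \<le> \<epsilon> n"
      proof (rule edge)
        show "?f contour_integrable_on linepath ?b ?b'" by (rule int) (use img in blast)
        have "?b' - ?b = of_real (c - (n + 1/2))" by (simp add: complex_eq_iff)
        hence "norm (?b' - ?b) = \<bar>c - (n + 1/2)\<bar>" by (simp only: norm_of_real)
        thus "norm (?b' - ?b) \<le> 2 * n + m + 1" by (simp add: c_def)
      qed (use c_le in \<open>auto simp: closed_segment_same_Im closed_segment_eq_real_ivl split: if_splits\<close>)
      have e4: "norm (contour_integral (linepath ?b' ?a) ?f) \<le> K * norm z powr c * pi"
      proof (rule norm_contour_integral_vertical_le[OF n0])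
        show "?f contour_integrable_on linepath ?b' ?a" by (rule int) (use img in blast)
      qed (use K z in auto)
      have "of_real (2 * pi) * \<i> * (?S + T n) = contour_integral (rectpath ?a ?b) ?f"
        using contour_integral_mellin_barnes_rectpath[OF z(1) n0, of m n \<alpha> \<beta>]
        unfolding sum_eq c_def by simp
      also have "\<dots> = contour_integral (linepath ?a ?a') ?f + contour_integral (linepath ?a' ?b) ?f
          + contour_integral (linepath ?b ?b') ?f + contour_integral (linepath ?b' ?a) ?f"
        using contour_integral_rectpath_split[OF cont] n0 c_le by simp
      finally have "norm (of_real (2 * pi) * \<i> * (?S + T n)) \<le> \<epsilon> n + \<epsilon> n + \<epsilon> n + K * norm z powr c * pi"
        using e1 e2 e3 e4 by (metis (no_types, lifting) norm_triangle_mono)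
      thus ?thesis by (simp add: norm_mult)
    qed
    have "T \<longlonglongrightarrow> mittag_leffler2 \<alpha> (of_real \<beta>) z"
      unfolding T_def mittag_leffler2_def
      by (rule summable_LIMSEQ'[OF summable_mittag_leffler2[OF assms(1)]])
    hence "(\<lambda>n. 2 * pi * norm (?S + T n)) \<longlonglongrightarrow> 2 * pi * norm (?S + mittag_leffler2 \<alpha> (of_real \<beta>) z)"
      by (intro tendsto_intros)
    moreover have "(\<lambda>n. K * norm z powr c * pi + 3 * \<epsilon> n) \<longlonglongrightarrow> K * norm z powr c * pi + 3 * 0"
      by (intro tendsto_intros \<epsilon>)
    ultimately have "2 * pi * norm (?S + mittag_leffler2 \<alpha> (of_real \<beta>) z) \<le> K * norm z powr c * pi + 3 * 0"
      by (rule LIMSEQ_le) (use bound in blast)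
    hence "pi * (2 * norm (?S + mittag_leffler2 \<alpha> (of_real \<beta>) z)) \<le> pi * (K * norm z powr c)"
      by (simp add: mult_ac)
    thus ?thesis by (simp add: add.commute)
  qed
  thus ?thesis using that[of "K / 2"] K(1) by (simp add: c_def)
qed

text \<open>When the terms below \<open>m\<close> vanish, only j = m is left, of order |z|^(-m).
  Away from the origin the remainder is of that order too, by |z|^(-1/2) \<le> r^(-1/2).\<close>

lemma mittag_leffler2_decay:
  fixes \<alpha> \<beta> :: real and m :: nat
  assumes "\<alpha> > 0" "\<psi> + \<alpha> * pi / 2 < pi" "r > 0"
    and "\<And>j. 1 \<le> j \<Longrightarrow> j < m \<Longrightarrow> rGamma (\<beta> - \<alpha> * j) = 0"
  obtains C where "C \<ge> 0" "\<And>z. norm z \<ge> r \<Longrightarrow> \<bar>Arg (- z)\<bar> \<le> \<psi> \<Longrightarrow>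
    norm (mittag_leffler2 \<alpha> (of_real \<beta>) z) \<le> C / norm z ^ m"
proof -
  obtain D where D: "D \<ge> 0" "\<And>z. z \<noteq> 0 \<Longrightarrow> \<bar>Arg (- z)\<bar> \<le> \<psi> \<Longrightarrow>
    norm (mittag_leffler2 \<alpha> (of_real \<beta>) z + (\<Sum>j=1..m. of_real (rGamma (\<beta> - \<alpha> * j)) / z ^ j))
      \<le> D * norm z powr (- real m - 1/2)"
    using mittag_leffler2_asymptotics[OF assms(1,2), where m = m and \<beta> = \<beta>] by blast
  let ?g = "\<bar>rGamma (\<beta> - \<alpha> * m)\<bar>"
  have "norm (mittag_leffler2 \<alpha> (of_real \<beta>) z) \<le> (D * r powr (- 1/2) + ?g) / norm z ^ m"
    if z: "norm z \<ge> r" "\<bar>Arg (- z)\<bar> \<le> \<psi>" for z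
  proof -
    let ?S = "\<Sum>j=1..m. of_real (rGamma (\<beta> - \<alpha> * j)) / z ^ j"
    have nz: "z \<noteq> 0" "norm z > 0" using z(1) assms(3) by auto
    have "norm ?S \<le> ?g / norm z ^ m"
    \<comment> \<open>For m = 0 the sum is empty; otherwise only its last term survives.\<close>
    proof (cases m)
      case (Suc k)
      hence "?S = of_real (rGamma (\<beta> - \<alpha> * m)) / z ^ m" using assms(4) by simp
      thus ?thesis by (simp add: norm_divide norm_power)
    qed simp
    moreover have "D * norm z powr (- real m - 1/2) \<le> D * r powr (- 1/2) / norm z ^ m"
    proof -
      have "norm z powr (- real m - 1/2) = norm z powr (- 1/2 - real m)"
        by (rule arg_cong[of _ _ "(powr) (norm z)"]) simp
      also have "\<dots> = norm z powr (- 1/2) / norm z ^ m"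
        using nz powr_diff[of "norm z" "- 1/2" "real m"] by (simp add: powr_realpow)
      also have "\<dots> \<le> r powr (- 1/2) / norm z ^ m"
        using assms(3) z(1) by (intro divide_right_mono powr_mono2') auto
      finally have "D * norm z powr (- real m - 1/2) \<le> D * (r powr (- 1/2) / norm z ^ m)"
        using D(1) by (intro mult_left_mono)
      thus ?thesis by simp
    qed
    ultimately show ?thesis
      using D(2)[OF nz(1) z(2)] norm_triangle_ineq4[of "mittag_leffler2 \<alpha> (of_real \<beta>) z + ?S" ?S]
      by (simp add: add_divide_distrib)
  qed
  thus ?thesis using that[of "D * r powr (- 1/2) + ?g"] D(1) by simp
qed

section \<open>Derivatives and the two decay rates\<close>

text \<open>Scaling by a positive number preserves arguments, so one disc around \<open>lam\<close>
  serves all \<open>T\<close> at once: on its boundary the arguments stay admissible and |x T| \<ge>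
  q T. Cauchy's inequality adds only the factor l! / \<rho>^l.\<close>

lemma deriv_mittag_leffler2_decay:
  fixes \<alpha> \<beta> :: real and m l :: nat
  assumes "\<alpha> > 0" "\<alpha> * pi / 2 < \<bar>Arg lam\<bar>"
    and "\<And>j. 1 \<le> j \<Longrightarrow> j < m \<Longrightarrow> rGamma (\<beta> - \<alpha> * j) = 0"
  obtains M where "M > 0" "\<And>T. T \<ge> 1 \<Longrightarrow>
    norm ((deriv ^^ l) (\<lambda>z. mittag_leffler2 \<alpha> (of_real \<beta>) (z * of_real T)) lam) \<le> M / T ^ m"
proof -
  \<comment> \<open>\<open>Arg 0\<close> is 0 by convention, which the lower bound on |Arg lam|
    excludes.\<close>
  have lam: "lam \<noteq> 0" using assms(1,2) by (auto simp: Arg_def mult_less_0_iff)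
  have arg: "\<bar>Arg (- lam)\<bar> < pi - \<alpha> * pi / 2" "- lam \<notin> \<real>\<^sub>\<le>\<^sub>0"
  proof -
    have "\<alpha> * pi / 2 > 0" using assms(1) by simp
    thus "\<bar>Arg (- lam)\<bar> < pi - \<alpha> * pi / 2"
      using Arg_minus[OF lam] assms(2) Arg_bounded[of lam] by (auto split: if_splits)
    hence "Arg (- lam) \<noteq> pi" using \<open>\<alpha> * pi / 2 > 0\<close> by auto
    thus "- lam \<notin> \<real>\<^sub>\<le>\<^sub>0" using lam by (auto simp: Arg_eq_pi complex_nonpos_Reals_iff complex_eq_iff)
  qed
  \<comment> \<open>The strict inequality leaves room for a slightly larger angle, which a whole
    neighbourhood of \<open>- lam\<close> respects.\<close>
  obtain \<psi> where \<psi>: "\<bar>Arg (- lam)\<bar> < \<psi>" "\<psi> < pi - \<alpha> * pi / 2" using dense[OF arg(1)] by blast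
  have "isCont (\<lambda>z. \<bar>Arg z\<bar>) (- lam)" using continuous_at_Arg[OF arg(2)] by (intro continuous_intros)
  hence "((\<lambda>z. \<bar>Arg z\<bar>) \<longlongrightarrow> \<bar>Arg (- lam)\<bar>) (nhds (- lam))"
    using tendsto_at_iff_tendsto_nhds[of "\<lambda>z. \<bar>Arg z\<bar>" "- lam"] by (simp add: isCont_def)
  hence "eventually (\<lambda>z. \<bar>Arg z\<bar> < \<psi>) (nhds (- lam))"
    using \<psi>(1) by (rule order_tendstoD)
  then obtain d where d: "d > 0" "\<And>z. dist z (- lam) < d \<Longrightarrow> \<bar>Arg z\<bar> < \<psi>"
    by (auto simp: eventually_nhds_metric)
  \<comment> \<open>Half of \<open>d\<close> keeps the closed disc inside that neighbourhood; half
    of |lam| keeps it at distance at least \<open>q\<close> from the origin.\<close>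
  define \<rho> where "\<rho> = min (d / 2) (norm lam / 2)"
  define q where "q = norm lam / 2"
  have \<rho>: "\<rho> > 0" "\<rho> < d" "\<rho> \<le> q" and q: "q > 0"
    using d(1) lam by (auto simp: \<rho>_def q_def)
  obtain C where C: "C \<ge> 0" "\<And>z. norm z \<ge> q \<Longrightarrow> \<bar>Arg (- z)\<bar> \<le> \<psi> \<Longrightarrow>
      norm (mittag_leffler2 \<alpha> (of_real \<beta>) z) \<le> C / norm z ^ m"
    using mittag_leffler2_decay[of \<alpha> \<psi> q m \<beta>] assms(1,3) \<psi>(2) q by (metis add.commute less_diff_eq)
  define M where "M = fact l * (C / q ^ m) / \<rho> ^ l"
  \<comment> \<open>\<open>M\<close> is 0 if \<open>C\<close> is; adding 1 makes the constant
    positive.\<close>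
  have "norm ((deriv ^^ l) (\<lambda>z. mittag_leffler2 \<alpha> (of_real \<beta>) (z * of_real T)) lam) \<le> (M + 1) / T ^ m"
    if T: "T \<ge> 1" for T
  proof -
    let ?F = "\<lambda>z. mittag_leffler2 \<alpha> (of_real \<beta>) (z * of_real T)"
    have hol: "?F holomorphic_on A" for A
    proof -
      have "(\<lambda>z. z * of_real T) holomorphic_on A" by (intro holomorphic_intros)
      from holomorphic_on_compose_gen[OF this holomorphic_mittag_leffler2[OF assms(1), of \<beta> UNIV]]
      show ?thesis by (simp add: o_def)
    qed
    have "norm ((deriv ^^ l) ?F lam) \<le> fact l * (C / (q * T) ^ m) / \<rho> ^ l"
    proof (rule Cauchy_inequality[OF hol holomorphic_on_imp_continuous_on[OF hol] \<rho>(1)])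
      fix x assume x: "norm (lam - x) = \<rho>"
      have "dist (- x) (- lam) < d" using x \<rho>(2) by (simp add: dist_norm norm_minus_commute)
      hence "\<bar>Arg (- x)\<bar> < \<psi>" by (rule d(2))
      moreover have "Arg (- (x * of_real T)) = Arg (- x)"
        using Arg_times_of_real[of T "- x"] T by (simp add: mult.commute)
      moreover have "q \<le> norm x" using x \<rho>(3) norm_triangle_ineq2[of lam x] by (simp add: q_def)
      hence qT: "q * T \<le> norm (x * of_real T)" using T by (simp add: norm_mult mult_right_mono)
      moreover have "q \<le> q * T" using q T by simp
      ultimately have "norm (?F x) \<le> C / norm (x * of_real T) ^ m" by (intro C(2)) auto
      also have "\<dots> \<le> C / (q * T) ^ m"
        using qT \<open>q \<le> q * T\<close> q T C(1)
        by (intro divide_left_mono power_mono mult_pos_pos zero_less_power) linarith+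
      finally show "norm (?F x) \<le> C / (q * T) ^ m" .
    qed
    also have "\<dots> = M / T ^ m" by (simp add: M_def power_mult_distrib)
    also have "\<dots> \<le> (M + 1) / T ^ m" using T by (intro divide_right_mono) auto
    finally show ?thesis .
  qed
  moreover have "M + 1 > 0" using C(1) q \<rho>(1) by (simp add: M_def add_nonneg_pos)
  ultimately show ?thesis using that by blast
qed

text \<open>Take T = t^\<alpha>. For \<beta> = 1 the expansion is used with m = 1; for \<beta> =
  \<alpha> its first coefficient is 1/Gamma(0) = 0, so m = 2 is admissible and the exponent
  doubles.\<close>

theorem lemma4:
  fixes \<alpha> :: real and lam :: complex and l :: nat
  assumes "0 < \<alpha>" and "\<alpha> < 1"
    and "lam \<noteq> 0"
    and "\<alpha> * pi / 2 < \<bar>Arg lam\<bar>" and "\<bar>Arg lam\<bar> \<le> pi"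
  shows "\<exists>M M' t\<^sub>0 :: real. M > 0 \<and> M' > 0 \<and> t\<^sub>0 > 0 \<and>
    (\<forall>t>t\<^sub>0. norm ((deriv ^^ l) (\<lambda>z. mittag_leffler \<alpha> (z * of_real (t powr \<alpha>))) lam)
              \<le> M / t powr \<alpha>) \<and>
    (\<forall>t>t\<^sub>0. norm ((deriv ^^ l) (\<lambda>z. mittag_leffler2 \<alpha> (of_real \<alpha>) (z * of_real (t powr \<alpha>))) lam)
              \<le> M' / t powr (2 * \<alpha>))"
proof -
  obtain M where M: "M > 0" "\<And>T. T \<ge> 1 \<Longrightarrow>
      norm ((deriv ^^ l) (\<lambda>z. mittag_leffler2 \<alpha> (of_real 1) (z * of_real T)) lam) \<le> M / T ^ 1"
    by (rule deriv_mittag_leffler2_decay[of \<alpha> lam 1 1 l]) (use assms in auto)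
  obtain M' where M': "M' > 0" "\<And>T. T \<ge> 1 \<Longrightarrow>
      norm ((deriv ^^ l) (\<lambda>z. mittag_leffler2 \<alpha> (of_real \<alpha>) (z * of_real T)) lam) \<le> M' / T ^ 2"
  proof (rule deriv_mittag_leffler2_decay[of \<alpha> lam 2 \<alpha> l])
    fix j :: nat assume "1 \<le> j" "j < 2"
    hence "j = 1" by simp
    thus "rGamma (\<alpha> - \<alpha> * j) = 0" by simp
  qed (use assms in auto)
  have T: "t powr \<alpha> \<ge> 1" "(t powr \<alpha>) ^ 2 = t powr (2 * \<alpha>)" if "t > 1" for t
    using that assms(1) by (auto simp: ge_one_powr_ge_zero power2_eq_square simp flip: powr_add)
  show ?thesis
  \<comment> \<open>The choice \<open>t\<^sub>0\<close> = 1 ensures t^\<alpha> \<ge> 1, the range in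
    which the derivative bounds hold.\<close>
  proof (rule exI[of _ M], rule exI[of _ M'], rule exI[of _ 1], intro conjI allI impI)
    fix t :: real assume t: "1 < t"
    show "norm ((deriv ^^ l) (\<lambda>z. mittag_leffler \<alpha> (z * of_real (t powr \<alpha>))) lam) \<le> M / t powr \<alpha>"
      using M(2)[OF T(1)[OF t]] by (simp add: mittag_leffler_def)
    show "norm ((deriv ^^ l) (\<lambda>z. mittag_leffler2 \<alpha> (of_real \<alpha>) (z * of_real (t powr \<alpha>))) lam)
        \<le> M' / t powr (2 * \<alpha>)"
      using M'(2)[OF T(1)[OF t]] by (simp only: T(2)[OF t])
  qed (use M(1) M'(1) in auto)
qed

end
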